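(* Let $g_0:\mathbb{R}^n\to\overline{\mathbb{R}}$ be proper and lsc, $h:\mathbb{R}^m\to\overline{\mathbb{R}}$ proper, lsc and nondecreasing, and let $G=(g_1,\dots,g_m):\Xi\times\mathbb{R}^n\to\mathbb{R}^m$ have random lsc component functions $g_i:\Xi\times\mathbb{R}^n\to\mathbb{R}$ with $g_i(\cdot,x)$ uniformly bounded on $\Xi$, locally uniformly in $x$. Let $\mu,\mu^\nu\in\mathscr{P}_{\rm mi}(\Xi)$ with $d_{\rm mi}(\mu^\nu,\mu)\to0$, let $\alpha\ge1$, and let $\lambda^\nu\in(0,\infty)\to0$ satisfy $\tfrac1{\lambda^\nu}d_{\rm mi}(\mu^\nu,\mu)^\alpha\to0$. Define $\phi(x)=g_0(x)+h(\mathbb{E}_\mu[G(\boldsymbol\xi,x)])$, $f(u,x)=g_0(x)+h(u+\mathbb{E}_\mu[G(\boldsymbol\xi,x)])+\iota_{\{0\}^m}(u)$ and $f^\nu(u,x)=g_0(x)+h(u+\mathbb{E}_{\mu^\nu}[G(\boldsymbol\xi,x)])+\tfrac1{\alpha\lambda^\nu}\|u\|_2^\alpha$, and suppose $\operatorname{argmin}\phi\ne\emptyset$. Then $f^\nu$ epi-converge to $f$, and: (a) $\inf f=\inf\phi$ and $\epsilon\text{-}\operatorname{argmin}f=\{0\}\times\epsilon\text{-}\operatorname{argmin}\phi$ for every $\epsilon\in[0,\infty)$; (b) $\limsup_\nu(\inf f^\nu)\le\inf f$; (c) if $\epsilon^\nu\in[0,\infty)\to\epsilon\in[0,\infty)$,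 then $\operatorname{LimOut}(\epsilon^\nu\text{-}\operatorname{argmin}f^\nu)\subseteq\epsilon\text{-}\operatorname{argmin}f$; (d) if $\epsilon^\nu\in[0,\infty)\to0$ and, for some infinite $N\subseteq\mathbb{N}$, points $(u^\nu,x^\nu)\in\epsilon^\nu\text{-}\operatorname{argmin}f^\nu$, $\nu\in N$, converge along $N$, then $\lim_{\nu\in N}(\inf f^\nu)=\inf f$; (e) $\inf f^\nu\to\inf f$ if and only if the functions $f^\nu$ are tight; (f) if $\inf f^\nu\to\inf f$, then for every $x_0\in\operatorname{argmin}\phi$ there exist $\epsilon^\nu\in[0,\infty)\to0$ with $(0,x_0)\in\operatorname{LimInn}(\epsilon^\nu\text{-}\operatorname{argmin}f^\nu)$; (g) if $\inf f^\nu\to\inf f$, then there exist $\epsilon^\nu\in[0,\infty)\to0$ such that $\operatorname{Lim}(\epsilon^\nu\text{-}\operatorname{argmin}f^\nu)=\operatorname{argmin}f$.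
   Context: $\Xi\subseteq\mathbb{R}^d$ is nonempty and closed; $\mathscr{P}(\Xi)$ is the set of Borel probability measures on $\Xi$; $\overline{\mathbb{R}}=[-\infty,\infty]$; lsc = lower semicontinuous; proper = never $-\infty$ and not identically $\infty$; $h$ nondecreasing means $h(y)\ge h(z)$ whenever $y\ge z$ componentwise. $\iota_C=0$ on $C$, $\infty$ off $C$. $g:\Xi\times\mathbb{R}^n\to\overline{\mathbb{R}}$ is random lsc if $\xi\mapsto\operatorname{epi}g(\xi,\cdot)=\{(x,t):g(\xi,x)\le t\}$ is closed-valued and measurable (i.e. $\{\xi:\operatorname{epi}g(\xi,\cdot)\cap O\ne\emptyset\}$ is Borel for every open $O\subseteq\mathbb{R}^{n+1}$). "$g_i(\cdot,x)$ uniformly bounded on $\Xi$, locally uniformly in $x$" means: for every $x\in\mathbb{R}^n$ there are $\epsilon_x>0$, $M_x<\infty$ with $|g_i(\xi,y)|\le M_x$ for all $\xi\in\Xi$ and $\|y-x\|_2\le\epsilon_x$. Minimal information metric (depends on $g_0,g_1,\dots,g_m$): $\mathscr{P}_{\rm mi}(\Xi)=\{\mu\in\mathscr{P}(\Xi):\sup_{x\in\operatorname{dom}g_0}\max_{1\le i\le m}|\int_\Xi g_i(\xi,x)\,\mu(d\xi)|<\infty\}$ and $d_{\rm mi}(\mu_1,\mu_2)=\sup_{x\in\operatorname{dom}g_0}\max_{1\le i\le m}\big|\int_\Xi g_i(\xi,x)\,(\mu_1-\mu_2)(d\xi)\big|$ for $\mu_1,\mu_2\in\mathscr{P}_{\rm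 mi}(\Xi)$. For $\psi:\mathbb{R}^k\to\overline{\mathbb{R}}$: $\operatorname{dom}\psi=\{\psi<\infty\}$, $\operatorname{argmin}\psi=\{z\in\operatorname{dom}\psi:\psi(z)=\inf\psi\}$, $\epsilon\text{-}\operatorname{argmin}\psi=\{z\in\operatorname{dom}\psi:\psi(z)\le\inf\psi+\epsilon\}$. For sets $C^\nu\subseteq\mathbb{R}^k$: $\operatorname{LimOut}C^\nu$ is the set of limits of sequences $z^\nu\in C^\nu$, $\nu\in N$, over infinite $N\subseteq\mathbb{N}$; $\operatorname{LimInn}C^\nu$ is the set of limits of sequences $z^\nu\in C^\nu$, $\nu\in\mathbb{N}$; $\operatorname{Lim}C^\nu=C$ means both equal $C$. $\psi^\nu$ epi-converge to $\psi$ if for every $z$: $\liminf\psi^\nu(z^\nu)\ge\psi(z)$ for all $z^\nu\to z$ and $\limsup\psi^\nu(z^\nu)\le\psi(z)$ for some $z^\nu\to z$. The $\psi^\nu$ are tight if for every $\epsilon>0$ there are a compact $S_\epsilon$ and $\nu_\epsilon$ with $\inf_{S_\epsilon}\psi^\nu\le\inf\psi^\nu+\epsilon$ for all $\nu\ge\nu_\epsilon$.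
   Formalization: In LimInn the points z^ν need lie in C^ν only for all sufficiently large ν, not for every ν∈ℕ; with literal membership for every ν, (f) and (g) fail when, e.g., inf f^0 = −∞ makes ε-argmin f^0 empty. *)

theory Defs
  imports "HOL-Analysis.Analysis"
begin

section \<open>Extended-real-valued functions\<close>

definition effdom :: "('a \<Rightarrow> ereal) \<Rightarrow> 'a set" where
  "effdom \<psi> = {z. \<psi> z < \<infinity>}"

definition proper_fun :: "('a \<Rightarrow> ereal) \<Rightarrow> bool" where
  "proper_fun \<psi> \<longleftrightarrow> (\<forall>z. \<psi> z \<noteq> -\<infinity>) \<and> (\<exists>z. \<psi> z \<noteq> \<infinity>)"

text \<open>The filter \<open>nhds z\<close> does not remove the point \<open>z\<close> itself, as usual for the lower
  limit of variational analysis.\<close>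

definition lsc :: "('a::topological_space \<Rightarrow> ereal) \<Rightarrow> bool" where
  "lsc \<psi> \<longleftrightarrow> (\<forall>z. \<psi> z \<le> Liminf (nhds z) \<psi>)"

definition indicator_fun :: "'a set \<Rightarrow> 'a \<Rightarrow> ereal" where
  "indicator_fun C z = (if z \<in> C then 0 else \<infinity>)"

definition argmin_set :: "('a \<Rightarrow> ereal) \<Rightarrow> 'a set" where
  "argmin_set \<psi> = {z \<in> effdom \<psi>. \<psi> z = (INF y. \<psi> y)}"

definition eps_argmin :: "real \<Rightarrow> ('a \<Rightarrow> ereal) \<Rightarrow> 'a set" where
  "eps_argmin \<epsilon> \<psi> = {z \<in> effdom \<psi>. \<psi> z \<le> (INF y. \<psi> y) + ereal \<epsilon>}"

section \<open>Limits of sets and of functions\<close>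

text \<open>Tails of a set \<open>N\<close> of indices: convergence along \<open>N\<close> of a sequence is convergence with
  respect to this filter, which ignores the values at indices outside \<open>N\<close>.\<close>

abbreviation along :: "nat set \<Rightarrow> nat filter" where
  "along N \<equiv> inf sequentially (principal N)"

definition LimOut :: "(nat \<Rightarrow> 'a::topological_space set) \<Rightarrow> 'a set" where
  "LimOut C = {z. \<exists>N w. infinite N \<and> (\<forall>\<nu>\<in>N. w \<nu> \<in> C \<nu>) \<and> (w \<longlongrightarrow> z) (along N)}"

text \<open>The points of the sequence need to be in the sets only from some index on, so that (as for
  any limit) the inner limit depends only on the tail of the sequence of sets; in particular
  finitely many empty sets \<open>C \<nu>\<close> do not make it empty.\<close>

definition LimInn :: "(nat \<Rightarrow> 'a::topological_space set) \<Rightarrow> 'a set" where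
  "LimInn C = {z. \<exists>w. (\<forall>\<^sub>F \<nu> in sequentially. w \<nu> \<in> C \<nu>) \<and> w \<longlonglongrightarrow> z}"

definition set_converges :: "(nat \<Rightarrow> 'a::topological_space set) \<Rightarrow> 'a set \<Rightarrow> bool" where
  "set_converges C S \<longleftrightarrow> LimOut C = S \<and> LimInn C = S"

definition epi_converges ::
    "(nat \<Rightarrow> 'a::topological_space \<Rightarrow> ereal) \<Rightarrow> ('a \<Rightarrow> ereal) \<Rightarrow> bool" where
  "epi_converges \<psi>s \<psi> \<longleftrightarrow>
    (\<forall>z. (\<forall>w. w \<longlonglongrightarrow> z \<longrightarrow> \<psi> z \<le> liminf (\<lambda>\<nu>. \<psi>s \<nu> (w \<nu>))) \<and>
         (\<exists>w. w \<longlonglongrightarrow> z \<and> limsup (\<lambda>\<nu>. \<psi>s \<nu> (w \<nu>)) \<le> \<psi> z))"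

definition tight_seq :: "(nat \<Rightarrow> 'a::topological_space \<Rightarrow> ereal) \<Rightarrow> bool" where
  "tight_seq \<psi>s \<longleftrightarrow>
    (\<forall>\<epsilon>::real. \<epsilon> > 0 \<longrightarrow>
      (\<exists>S \<nu>\<^sub>0. compact S \<and>
        (\<forall>\<nu>\<ge>\<nu>\<^sub>0. (INF z\<in>S. \<psi>s \<nu> z) \<le> (INF z. \<psi>s \<nu> z) + ereal \<epsilon>)))"

section \<open>Random functions and probability measures\<close>

definition epigraph :: "('a \<Rightarrow> ereal) \<Rightarrow> ('a \<times> real) set" where
  "epigraph \<psi> = {(x, t). \<psi> x \<le> ereal t}"

definition random_lsc ::
    "'a::topological_space set \<Rightarrow> ('a \<Rightarrow> 'b::topological_space \<Rightarrow> ereal) \<Rightarrow> bool" where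
  "random_lsc \<Xi> g \<longleftrightarrow>
    (\<forall>\<xi>\<in>\<Xi>. closed (epigraph (g \<xi>))) \<and>
    (\<forall>U. open U \<longrightarrow>
      {\<xi>\<in>\<Xi>. epigraph (g \<xi>) \<inter> U \<noteq> {}} \<in> sets (restrict_space borel \<Xi>))"

definition locally_uniformly_bounded ::
    "'a set \<Rightarrow> ('a \<Rightarrow> 'b::real_normed_vector \<Rightarrow> real) \<Rightarrow> bool" where
  "locally_uniformly_bounded \<Xi> g \<longleftrightarrow>
    (\<forall>x. \<exists>\<epsilon>>0. \<exists>M. \<forall>\<xi>\<in>\<Xi>. \<forall>y. norm (y - x) \<le> \<epsilon> \<longrightarrow> \<bar>g \<xi> y\<bar> \<le> M)"

definition prob_measures :: "'a::topological_space set \<Rightarrow> 'a measure set" where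
  "prob_measures \<Xi> =
    {\<mu>. sets \<mu> = sets (restrict_space borel \<Xi>) \<and> emeasure \<mu> (space \<mu>) = 1}"

text \<open>The supremum defining \<open>mi_measures\<close> is taken in the extended reals. The one in \<open>d_mi\<close> is a
  real supremum, which is the intended one for two members of \<open>mi_measures\<close>, as the set is then
  bounded above, and nonempty if \<open>g\<^sub>0\<close> is proper.\<close>

definition mi_measures ::
    "'a::topological_space set \<Rightarrow> ('b \<Rightarrow> ereal) \<Rightarrow> ('a \<Rightarrow> 'b \<Rightarrow> real^'m) \<Rightarrow> 'a measure set" where
  "mi_measures \<Xi> g\<^sub>0 G =
    {\<mu> \<in> prob_measures \<Xi>.
      (SUP x\<in>effdom g\<^sub>0. MAX i\<in>UNIV. ereal \<bar>\<integral>\<xi>. G \<xi> x $ i \<partial>\<mu>\<bar>) < \<infinity>}"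

definition d_mi ::
    "('b \<Rightarrow> ereal) \<Rightarrow> ('a \<Rightarrow> 'b \<Rightarrow> real^'m) \<Rightarrow> 'a measure \<Rightarrow> 'a measure \<Rightarrow> real" where
  "d_mi g\<^sub>0 G \<mu>\<^sub>1 \<mu>\<^sub>2 =
    (SUP x\<in>effdom g\<^sub>0. MAX i\<in>UNIV. \<bar>(\<integral>\<xi>. G \<xi> x $ i \<partial>\<mu>\<^sub>1) - (\<integral>\<xi>. G \<xi> x $ i \<partial>\<mu>\<^sub>2)\<bar>)"

end

theory Submission
  imports Defs
begin

text \<open>
  The lower epi-limit rests on replacing the argument \<open>u\<^sup>\<nu> + E\<^sub>\<nu> G(x\<^sup>\<nu>)\<close> of \<open>h\<close> by a smaller one that
  converges. On \<open>dom g\<^sub>0\<close> the components of \<open>E\<^sub>\<nu> G\<close> and \<open>E G\<close> differ by at most \<open>d\<^sup>\<nu>\<close>, and \<open>E G\<close> is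
  componentwise lower semicontinuous by Fatou's lemma. Hence the componentwise minimum of
  \<open>u\<^sup>\<nu> - d\<^sup>\<nu> + E G(x\<^sup>\<nu>)\<close> and \<open>u + E G(x)\<close> converges to the latter, and monotonicity and lower
  semicontinuity of \<open>h\<close> apply. A recovery sequence for \<open>(0, x)\<close> is \<open>(E G(x) - E\<^sub>\<nu> G(x), x)\<close>: it
  leaves the argument of \<open>h\<close> unchanged and costs a penalty of order \<open>(d\<^sup>\<nu>)\<^sup>\<alpha> / \<lambda>\<^sup>\<nu>\<close>. Everything else
  holds for any epi-convergent sequence whose limit has a finite infimum that is attained; in (g)
  the tolerances come from a diagonal argument over a countable dense subset of the minimizers.
\<close>

section \<open>Minimization and epi-convergence\<close>

lemma diagonal_index:
  fixes P :: "nat \<Rightarrow> nat \<Rightarrow> bool"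
  assumes "\<And>j. \<forall>\<^sub>F \<nu> in sequentially. P j \<nu>"
  obtains k where "filterlim k at_top sequentially" "\<forall>\<^sub>F \<nu> in sequentially. P (k \<nu>) \<nu>"
proof -
  obtain N where N: "\<And>j \<nu>. N j \<le> \<nu> \<Longrightarrow> P j \<nu>"
    using assms unfolding eventually_sequentially by metis
  \<comment> \<open>The bound \<open>j \<le> \<nu>\<close> keeps the set finite, so that its maximum
    exists; the set contains 0 as soon as \<open>N 0 \<le> \<nu>\<close>.\<close>
  define A where "A \<nu> = {j. j \<le> \<nu> \<and> N j \<le> \<nu>}" for \<nu>
  define k where "k \<nu> = Max (A \<nu>)" for \<nu>
  have fin: "finite (A \<nu>)" for \<nu>
    by (auto simp: A_def)
  have "filterlim k at_top sequentially"
    unfolding filterlim_at_top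
  proof
    fix J
    show "\<forall>\<^sub>F \<nu> in sequentially. J \<le> k \<nu>"
      using eventually_ge_at_top[of "max J (N J)"]
      by eventually_elim (auto simp: k_def A_def intro!: Max_ge)
  qed
  moreover have "\<forall>\<^sub>F \<nu> in sequentially. P (k \<nu>) \<nu>"
    using eventually_ge_at_top[of "N 0"]
  proof eventually_elim
    case (elim \<nu>)
    then have "A \<nu> \<noteq> {}"
      by (auto simp: A_def)
    then have "k \<nu> \<in> A \<nu>"
      using fin Max_in by (auto simp: k_def)
    then show ?case
      by (auto simp: A_def intro: N)
  qed
  ultimately show thesis
    by (rule that)
qed

section \<open>Convergence along index sets, inner and outer limits\<close>

lemma along_neq_bot:
  assumes "infinite N"
  shows "along N \<noteq> bot"
proof
  assume "along N = bot"
  then have "\<forall>\<^sub>F \<nu> in sequentially. \<nu> \<notin> N"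
    by (metis (mono_tags, lifting) eventually_bot eventually_inf_principal eventually_mono)
  with assms show False
    by (metis eventually_sequentially infinite_nat_iff_unbounded_le)
qed

lemma along_le: "along N \<le> sequentially"
  by simp

text \<open>Frees the inner limit from the choice of a sequence: approximability can be checked for
  each radius separately. For the converse, the radius shrinks along a diagonal index, and a point
  of \<open>C \<nu>\<close> within that radius is chosen.\<close>

lemma LimInn_iff:
  fixes C :: "nat \<Rightarrow> 'a::metric_space set"
  shows "z \<in> LimInn C \<longleftrightarrow> (\<forall>\<delta>>0. \<forall>\<^sub>F \<nu> in sequentially. \<exists>y\<in>C \<nu>. dist y z < \<delta>)"
proof
  assume "z \<in> LimInn C"
  then obtain w where w: "\<forall>\<^sub>F \<nu> in sequentially. w \<nu> \<in> C \<nu>" "w \<longlonglongrightarrow> z"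
    by (auto simp: LimInn_def)
  show "\<forall>\<delta>>0. \<forall>\<^sub>F \<nu> in sequentially. \<exists>y\<in>C \<nu>. dist y z < \<delta>"
  proof (intro allI impI)
    fix \<delta> :: real
    assume "\<delta> > 0"
    show "\<forall>\<^sub>F \<nu> in sequentially. \<exists>y\<in>C \<nu>. dist y z < \<delta>"
      using w(1) tendstoD[OF w(2) \<open>\<delta> > 0\<close>] by eventually_elim auto
  qed
next
  assume *: "\<forall>\<delta>>0. \<forall>\<^sub>F \<nu> in sequentially. \<exists>y\<in>C \<nu>. dist y z < \<delta>"
  obtain k where k: "filterlim k at_top sequentially"
      "\<forall>\<^sub>F \<nu> in sequentially. \<exists>y\<in>C \<nu>. dist y z < 1 / real (Suc (k \<nu>))"
  proof (rule diagonal_index)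
    show "\<forall>\<^sub>F \<nu> in sequentially. \<exists>y\<in>C \<nu>. dist y z < 1 / real (Suc j)" for j
      using * by simp
  qed
  define w where "w \<nu> = (SOME y. y \<in> C \<nu> \<and> dist y z < 1 / real (Suc (k \<nu>)))" for \<nu>
  have w: "\<forall>\<^sub>F \<nu> in sequentially. w \<nu> \<in> C \<nu> \<and> dist (w \<nu>) z < 1 / real (Suc (k \<nu>))"
    using k(2)
  proof eventually_elim
    case (elim \<nu>)
    then have "\<exists>y. y \<in> C \<nu> \<and> dist y z < 1 / real (Suc (k \<nu>))"
      by blast
    then show ?case
      unfolding w_def by (rule someI_ex)
  qed
  have "(\<lambda>\<nu>. 1 / real (Suc (k \<nu>))) \<longlonglongrightarrow> 0"
    using filterlim_compose[OF LIMSEQ_inverse_real_of_nat k(1)] by (simp add: divide_inverse)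
  moreover have "\<forall>\<^sub>F \<nu> in sequentially. norm (dist (w \<nu>) z) \<le> 1 / real (Suc (k \<nu>))"
    using w by eventually_elim auto
  ultimately have "(\<lambda>\<nu>. dist (w \<nu>) z) \<longlonglongrightarrow> 0"
    by (rule Lim_null_comparison[rotated])
  then have "w \<longlonglongrightarrow> z"
    by (rule iffD2[OF tendsto_dist_iff])
  moreover have "\<forall>\<^sub>F \<nu> in sequentially. w \<nu> \<in> C \<nu>"
    using w by eventually_elim auto
  ultimately show "z \<in> LimInn C"
    by (auto simp: LimInn_def)
qed

lemma LimInn_subset_LimOut: "LimInn C \<subseteq> LimOut C"
proof
  fix z
  assume "z \<in> LimInn C"
  then obtain w n where w: "\<forall>\<nu>\<ge>n. w \<nu> \<in> C \<nu>" "w \<longlonglongrightarrow> z"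
    by (auto simp: LimInn_def eventually_sequentially)
  have "(w \<longlongrightarrow> z) (along {n..})"
    using w(2) by (rule tendsto_mono[OF along_le])
  then show "z \<in> LimOut C"
    using w(1) by (auto simp: LimOut_def intro!: exI[of _ "{n..}"] exI[of _ w] infinite_Ici)
qed

text \<open>The lower bound in epi-convergence speaks of full sequences only. Filling the indices
  outside \<open>N\<close> with the limit \<open>z\<close> gives a full sequence that converges to
  \<open>z\<close> and agrees with \<open>w\<close> on \<open>N\<close>.\<close>

lemma epi_converges_liminf_along:
  assumes "epi_converges \<psi>s \<psi>" "(w \<longlongrightarrow> z) (along N)" "c < \<psi> z"
  shows "\<forall>\<^sub>F \<nu> in along N. c < \<psi>s \<nu> (w \<nu>)"
proof -
  define w' where "w' \<nu> = (if \<nu> \<in> N then w \<nu> else z)" for \<nu>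
  have "w' \<longlonglongrightarrow> z"
  proof (rule topological_tendstoI)
    fix S
    assume S: "open S" "z \<in> S"
    then have "\<forall>\<^sub>F \<nu> in sequentially. \<nu> \<in> N \<longrightarrow> w \<nu> \<in> S"
      using assms(2) by (auto dest: topological_tendstoD simp: eventually_inf_principal)
    then show "\<forall>\<^sub>F \<nu> in sequentially. w' \<nu> \<in> S"
      by eventually_elim (auto simp: w'_def S)
  qed
  then have "\<psi> z \<le> liminf (\<lambda>\<nu>. \<psi>s \<nu> (w' \<nu>))"
    using assms(1) by (auto simp: epi_converges_def)
  then have "\<forall>\<^sub>F \<nu> in sequentially. c < \<psi>s \<nu> (w' \<nu>)"
    using assms(3) by (auto simp: le_Liminf_iff)
  then show ?thesis
    unfolding eventually_inf_principal by eventually_elim (auto simp: w'_def)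
qed

text \<open>Recasts the limsup bound as strict eventual bounds, which combine directly with other
  eventual statements.\<close>

lemma epi_converges_recovery:
  assumes "epi_converges \<psi>s \<psi>"
  obtains w where "w \<longlonglongrightarrow> z" "\<And>c. \<psi> z < c \<Longrightarrow> \<forall>\<^sub>F \<nu> in sequentially. \<psi>s \<nu> (w \<nu>) < c"
proof -
  obtain w where "w \<longlonglongrightarrow> z" "limsup (\<lambda>\<nu>. \<psi>s \<nu> (w \<nu>)) \<le> \<psi> z"
    using assms unfolding epi_converges_def by blast
  then show thesis
    by (auto simp: Limsup_le_iff intro: that)
qed

text \<open>Each infimum lies below the value at a recovery sequence of any given \<open>z\<close>,
  and \<open>z\<close> is arbitrary.\<close>

lemma epi_converges_limsup_INF:
  assumes "epi_converges \<psi>s \<psi>"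
  shows "limsup (\<lambda>\<nu>. INF z. \<psi>s \<nu> z) \<le> (INF z. \<psi> z)"
proof (rule INF_greatest)
  fix z
  obtain w where w: "\<And>c. \<psi> z < c \<Longrightarrow> \<forall>\<^sub>F \<nu> in sequentially. \<psi>s \<nu> (w \<nu>) < c"
    using epi_converges_recovery[OF assms] by metis
  show "limsup (\<lambda>\<nu>. INF z. \<psi>s \<nu> z) \<le> \<psi> z"
    unfolding Limsup_le_iff
    by (auto intro: eventually_mono[OF w] le_less_trans[OF INF_lower])
qed

section \<open>Infima and near-minimizers when the limit has a finite infimum\<close>

locale epi_limit =
  fixes \<psi>s :: "nat \<Rightarrow> 'a::{heine_borel, second_countable_topology} \<Rightarrow> ereal"
    and \<psi> :: "'a \<Rightarrow> ereal" and m :: real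
  assumes epi: "epi_converges \<psi>s \<psi>"
    and INF_eq: "(INF z. \<psi> z) = ereal m"
begin

abbreviation "ms \<nu> \<equiv> INF z. \<psi>s \<nu> z"

lemma eventually_INF_less: "ereal m < c \<Longrightarrow> \<forall>\<^sub>F \<nu> in sequentially. ms \<nu> < c"
  using epi_converges_limsup_INF[OF epi] by (auto simp: INF_eq Limsup_le_iff)

lemma m_le: "ereal m \<le> \<psi> z"
  using INF_lower[of z UNIV \<psi>] by (simp add: INF_eq)

text \<open>The infima are asymptotically at most \<open>m\<close>, so values at the near-minimizers
  are asymptotically at most \<open>m + \<epsilon>\<close>; the lower epi-bound passes this on to
  \<open>z\<close>. As \<open>m + \<epsilon>\<close> is real, \<open>z\<close> then also lies in the
  effective domain.\<close>

lemma eps_argmin_limit: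
  assumes eps: "\<epsilon>s \<longlonglongrightarrow> \<epsilon>" and N: "infinite N"
    and w: "\<forall>\<nu>\<in>N. w \<nu> \<in> eps_argmin (\<epsilon>s \<nu>) (\<psi>s \<nu>)" "(w \<longlongrightarrow> z) (along N)"
  shows "z \<in> eps_argmin \<epsilon> \<psi>"
proof -
  have "\<psi> z \<le> ereal (m + \<epsilon>)"
  proof (rule ccontr)
    assume "\<not> \<psi> z \<le> ereal (m + \<epsilon>)"
    then obtain c where c: "m + \<epsilon> < c" "ereal c < \<psi> z"
      by (metis ereal_dense2 ereal_less_eq(3) less_eq_ereal_def not_le less_ereal.simps(1))
    \<comment> \<open>Half of the gap between \<open>m + \<epsilon>\<close> and \<open>c\<close> is
      allotted to the infimum and half to the tolerance, so that the two bounds add up to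
      \<open>c\<close>.\<close>
    define \<delta> where "\<delta> = (c - m - \<epsilon>) / 2"
    have \<delta>: "\<delta> > 0" "m + \<delta> + (\<epsilon> + \<delta>) = c"
      using c by (auto simp: \<delta>_def)
    have "\<forall>\<^sub>F \<nu> in along N. ereal c < \<psi>s \<nu> (w \<nu>)"
      by (rule epi_converges_liminf_along[OF epi w(2) c(2)])
    moreover have "\<forall>\<^sub>F \<nu> in along N. ms \<nu> < ereal (m + \<delta>)"
      using eventually_INF_less \<delta> by (intro filter_leD[OF along_le]) auto
    moreover have "\<forall>\<^sub>F \<nu> in along N. \<epsilon>s \<nu> < \<epsilon> + \<delta>"
      using order_tendstoD(2)[OF eps] \<delta> by (intro filter_leD[OF along_le]) auto
    moreover have "\<forall>\<^sub>F \<nu> in along N. \<psi>s \<nu> (w \<nu>) \<le> ms \<nu> + ereal (\<epsilon>s \<nu>)"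
      using w(1) by (auto simp: eventually_inf_principal eps_argmin_def)
    ultimately have "\<forall>\<^sub>F \<nu> in along N. False"
    proof eventually_elim
      case (elim \<nu>)
      have "ms \<nu> + ereal (\<epsilon>s \<nu>) \<le> ereal (m + \<delta>) + ereal (\<epsilon> + \<delta>)"
        using elim by (intro add_mono) auto
      also have "\<dots> = ereal c"
        using \<delta> by simp
      finally show ?case
        using elim by auto
    qed
    then show False
      using along_neq_bot[OF N] by (simp add: eventually_False)
  qed
  then show ?thesis
    by (auto simp: eps_argmin_def effdom_def INF_eq)
qed

lemma LimOut_eps_argmin_subset:
  assumes "\<epsilon>s \<longlonglongrightarrow> \<epsilon>"
  shows "LimOut (\<lambda>\<nu>. eps_argmin (\<epsilon>s \<nu>) (\<psi>s \<nu>)) \<subseteq> eps_argmin \<epsilon> \<psi>"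
  using eps_argmin_limit[OF assms] by (auto simp: LimOut_def)

text \<open>The upper half holds for every epi-convergent sequence. For the lower half, the values
  at the near-minimizers eventually exceed any real below \<open>m \<le> \<psi> z\<close>, and the
  infima trail these values by a vanishing tolerance.\<close>

lemma INF_tendsto_along:
  assumes eps: "\<epsilon>s \<longlonglongrightarrow> 0"
    and w: "\<forall>\<nu>\<in>N. w \<nu> \<in> eps_argmin (\<epsilon>s \<nu>) (\<psi>s \<nu>)" "(w \<longlongrightarrow> z) (along N)"
  shows "(ms \<longlongrightarrow> ereal m) (along N)"
proof (rule order_tendstoI)
  fix c
  assume "ereal m < c"
  then show "\<forall>\<^sub>F \<nu> in along N. ms \<nu> < c"
    using eventually_INF_less by (intro filter_leD[OF along_le]) auto
next
  fix a
  assume "a < ereal m"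
  then obtain b where b: "a < ereal b" "b < m"
    by (metis ereal_dense2 less_ereal.simps(1))
  \<comment> \<open>The bound \<open>a\<close> may be \<open>-\<infinity>\<close>, hence the real
    \<open>b\<close> above it; the midpoint \<open>c\<close> leaves the room \<open>c - b\<close> to
    absorb the tolerance.\<close>
  define c where "c = (b + m) / 2"
  have c: "b < c" "c < m"
    using b by (auto simp: c_def)
  have "\<forall>\<^sub>F \<nu> in along N. ereal c < \<psi>s \<nu> (w \<nu>)"
    using c m_le[of z] by (intro epi_converges_liminf_along[OF epi w(2)]) (auto intro: less_le_trans[of _ "ereal m"])
  moreover have "\<forall>\<^sub>F \<nu> in along N. \<epsilon>s \<nu> < c - b"
    using order_tendstoD(2)[OF eps] c by (intro filter_leD[OF along_le]) auto
  moreover have "\<forall>\<^sub>F \<nu> in along N. \<psi>s \<nu> (w \<nu>) \<le> ms \<nu> + ereal (\<epsilon>s \<nu>)"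
    using w(1) by (auto simp: eventually_inf_principal eps_argmin_def)
  ultimately show "\<forall>\<^sub>F \<nu> in along N. a < ms \<nu>"
  proof eventually_elim
    case (elim \<nu>)
    then have "ereal c < ms \<nu> + ereal (\<epsilon>s \<nu>)"
      by auto
    then have "ereal b < ms \<nu>"
      using elim(2) by (cases "ms \<nu>") auto
    then show ?case
      using b by auto
  qed
qed

text \<open>If the infima were at most \<open>a\<close> infinitely often, tightness would put points
  of value below some \<open>c < m\<close> into a fixed compact set. A cluster point of these would
  violate the lower epi-bound, since \<open>\<psi>\<close> is nowhere below
  \<open>m\<close>.\<close>

lemma INF_tendsto_if_tight:
  assumes tight: "tight_seq \<psi>s"
  shows "ms \<longlonglongrightarrow> ereal m"
proof (rule order_tendstoI)
  fix c
  assume "ereal m < c"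
  then show "\<forall>\<^sub>F \<nu> in sequentially. ms \<nu> < c"
    by (rule eventually_INF_less)
next
  fix a
  assume "a < ereal m"
  then obtain b where b: "a < ereal b" "b < m"
    by (metis ereal_dense2 less_ereal.simps(1))
  define c where "c = (b + m) / 2"
  have c: "b < c" "c < m"
    using b by (auto simp: c_def)
  have "c - b > 0"
    using c by simp
  then obtain S \<nu>\<^sub>0 where S: "compact S"
      "\<forall>\<nu>\<ge>\<nu>\<^sub>0. (INF z\<in>S. \<psi>s \<nu> z) \<le> ms \<nu> + ereal (c - b)"
    using tight unfolding tight_seq_def by blast
  show "\<forall>\<^sub>F \<nu> in sequentially. a < ms \<nu>"
  proof (rule ccontr)
    assume *: "\<not> (\<forall>\<^sub>F \<nu> in sequentially. a < ms \<nu>)"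
    define A where "A = {\<nu>. \<nu>\<^sub>0 \<le> \<nu> \<and> \<not> a < ms \<nu>}"
    have "infinite A"
      unfolding infinite_nat_iff_unbounded_le
    proof
      fix n
      obtain \<nu> where "\<nu> \<ge> max n \<nu>\<^sub>0" "\<not> a < ms \<nu>"
        using * unfolding eventually_sequentially by blast
      then show "\<exists>\<nu>\<ge>n. \<nu> \<in> A"
        by (auto simp: A_def)
    qed
    then obtain r :: "nat \<Rightarrow> nat" where r: "strict_mono r" "\<And>k. r k \<in> A"
      using infinite_enumerate by blast
    have "\<exists>y\<in>S. \<psi>s \<nu> y < ereal c" if "\<nu> \<in> A" for \<nu>
    proof -
      have "ms \<nu> < ereal b"
        using that b by (auto simp: A_def intro: le_less_trans)
      \<comment> \<open>The case distinction covers \<open>ms \<nu> = -\<infinity>\<close>, where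
        the sum is \<open>-\<infinity>\<close> as well.\<close>
      then have "ms \<nu> + ereal (c - b) < ereal c"
        by (cases "ms \<nu>") auto
      moreover have "(INF z\<in>S. \<psi>s \<nu> z) \<le> ms \<nu> + ereal (c - b)"
        using S(2) that by (auto simp: A_def)
      ultimately have "(INF z\<in>S. \<psi>s \<nu> z) < ereal c"
        by (rule le_less_trans[rotated])
      then show ?thesis
        by (simp add: INF_less_iff)
    qed
    then obtain y where y: "\<And>\<nu>. \<nu> \<in> A \<Longrightarrow> y \<nu> \<in> S \<and> \<psi>s \<nu> (y \<nu>) < ereal c"
      by metis
    have "seq_compact S"
      using S(1) by (simp add: compact_eq_seq_compact_metric)
    then obtain z s where s: "z \<in> S" "strict_mono s" "((y \<circ> r) \<circ> s) \<longlonglongrightarrow> z"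
      using y r(2) by (auto elim!: seq_compactE[of S "y \<circ> r"])
    \<comment> \<open>The range of the subsequence becomes the index set, which turns convergence of
      the subsequence into convergence along \<open>N\<close>; strict monotonicity makes
      \<open>N\<close> infinite.\<close>
    define N where "N = range (r \<circ> s)"
    have rs: "strict_mono (r \<circ> s)"
      using r(1) s(2) by (rule strict_mono_o)
    have N: "infinite N" "N \<subseteq> A"
      using range_inj_infinite[OF strict_mono_imp_inj_on[OF rs]] r(2) by (auto simp: N_def)
    have "(y \<longlongrightarrow> z) (along N)"
    proof (rule topological_tendstoI)
      fix U
      assume "open U" "z \<in> U"
      then obtain n where n: "\<forall>k\<ge>n. y (r (s k)) \<in> U"
        using topological_tendstoD[OF s(3)] by (auto simp: eventually_sequentially)
      have "\<forall>\<nu>\<ge>r (s n). \<nu> \<in> N \<longrightarrow> y \<nu> \<in> U"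
        using n strict_mono_less_eq[OF rs] by (auto simp: N_def)
      then show "\<forall>\<^sub>F \<nu> in along N. y \<nu> \<in> U"
        unfolding eventually_inf_principal eventually_sequentially by blast
    qed
    moreover have "ereal c < \<psi> z"
      using c m_le[of z] by (auto intro: less_le_trans[of _ "ereal m"])
    ultimately have "\<forall>\<^sub>F \<nu> in along N. ereal c < \<psi>s \<nu> (y \<nu>)"
      by (rule epi_converges_liminf_along[OF epi])
    moreover have "\<forall>\<^sub>F \<nu> in along N. \<psi>s \<nu> (y \<nu>) < ereal c"
      using y N(2) unfolding eventually_inf_principal by (intro always_eventually) blast
    ultimately have "\<forall>\<^sub>F \<nu> in along N. False"
      by eventually_elim auto
    then show False
      using along_neq_bot[OF N(1)] by (simp add: eventually_False)
  qed
qed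

text \<open>At a minimizer the recovery values are asymptotically at most \<open>m\<close>, while
  the infima tend to \<open>m\<close>. Allowing each an error of \<open>\<delta> / 2\<close> closes
  the gap, and the same sequence serves every \<open>\<delta>\<close>.\<close>

lemma recovery_in_eps_argmin:
  assumes lim: "ms \<longlonglongrightarrow> ereal m" and z: "z \<in> argmin_set \<psi>"
  obtains w where "w \<longlonglongrightarrow> z"
    "\<And>\<delta>. \<delta> > 0 \<Longrightarrow> \<forall>\<^sub>F \<nu> in sequentially. w \<nu> \<in> eps_argmin \<delta> (\<psi>s \<nu>)"
proof -
  obtain w where w: "w \<longlonglongrightarrow> z" "\<And>c. \<psi> z < c \<Longrightarrow> \<forall>\<^sub>F \<nu> in sequentially. \<psi>s \<nu> (w \<nu>) < c"
    using epi_converges_recovery[OF epi] by metis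
  have "\<forall>\<^sub>F \<nu> in sequentially. w \<nu> \<in> eps_argmin \<delta> (\<psi>s \<nu>)" if "\<delta> > 0" for \<delta>
  proof -
    have "\<psi> z < ereal (m + \<delta> / 2)" "ereal (m - \<delta> / 2) < ereal m"
      using z that by (auto simp: argmin_set_def INF_eq)
    then have "\<forall>\<^sub>F \<nu> in sequentially. \<psi>s \<nu> (w \<nu>) < ereal (m + \<delta> / 2)"
        "\<forall>\<^sub>F \<nu> in sequentially. ereal (m - \<delta> / 2) < ms \<nu>"
      using w(2) order_tendstoD(1)[OF lim] by auto
    then show ?thesis
    proof eventually_elim
      case (elim \<nu>)
      have "ereal (m + \<delta> / 2) = ereal (m - \<delta> / 2) + ereal \<delta>"
        by simp
      also have "\<dots> \<le> ms \<nu> + ereal \<delta>"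
        using elim by (intro add_right_mono) auto
      finally have "\<psi>s \<nu> (w \<nu>) \<le> ms \<nu> + ereal \<delta>"
        using elim(1) by auto
      moreover have "\<psi>s \<nu> (w \<nu>) < \<infinity>"
        using elim(1) by auto
      ultimately show ?case
        by (auto simp: eps_argmin_def effdom_def)
    qed
  qed
  with w(1) show thesis
    by (rule that)
qed

text \<open>A recovery sequence of a minimizer together with its limit is compact, and its terms are
  eventually near-minimizers.\<close>

lemma tight_if_INF_tendsto:
  assumes lim: "ms \<longlonglongrightarrow> ereal m" and z: "z \<in> argmin_set \<psi>"
  shows "tight_seq \<psi>s"
  unfolding tight_seq_def
proof (intro allI impI)
  fix \<epsilon> :: real
  assume "\<epsilon> > 0"
  obtain w where w: "w \<longlonglongrightarrow> z"
      "\<And>\<delta>. \<delta> > 0 \<Longrightarrow> \<forall>\<^sub>F \<nu> in sequentially. w \<nu> \<in> eps_argmin \<delta> (\<psi>s \<nu>)"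
    using recovery_in_eps_argmin[OF lim z] by metis
  obtain \<nu>\<^sub>0 where \<nu>\<^sub>0: "\<forall>\<nu>\<ge>\<nu>\<^sub>0. w \<nu> \<in> eps_argmin \<epsilon> (\<psi>s \<nu>)"
    using w(2)[OF \<open>\<epsilon> > 0\<close>] by (auto simp: eventually_sequentially)
  have "(INF y\<in>insert z (range w). \<psi>s \<nu> y) \<le> ms \<nu> + ereal \<epsilon>" if "\<nu> \<ge> \<nu>\<^sub>0" for \<nu>
    using \<nu>\<^sub>0 that by (intro INF_lower2[of "w \<nu>"]) (auto simp: eps_argmin_def)
  then show "\<exists>S \<nu>\<^sub>0. compact S \<and> (\<forall>\<nu>\<ge>\<nu>\<^sub>0. (INF z\<in>S. \<psi>s \<nu> z) \<le> ms \<nu> + ereal \<epsilon>)"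
    using compact_sequence_with_limit[OF w(1)] by blast
qed

text \<open>A diagonal argument handles countably many conditions, whereas the minimizers may be
  uncountable. A countable dense subset suffices because membership in an inner limit only asks for
  approximation within every radius.\<close>

lemma eps_argmin_converges:
  assumes lim: "ms \<longlonglongrightarrow> ereal m"
  obtains \<epsilon>s where "\<And>\<nu>. 0 \<le> \<epsilon>s \<nu>" "\<epsilon>s \<longlonglongrightarrow> 0"
    "set_converges (\<lambda>\<nu>. eps_argmin (\<epsilon>s \<nu>) (\<psi>s \<nu>)) (argmin_set \<psi>)"
proof -
  obtain T where T: "countable T" "T \<subseteq> argmin_set \<psi>" "argmin_set \<psi> \<subseteq> closure T"
    using separable by metis
  \<comment> \<open>Only the points with index up to \<open>j\<close> are considered, so
    \<open>P j\<close> is a finite conjunction of conditions that hold eventually. The intersection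
    with \<open>T\<close> matters for empty \<open>T\<close>, where \<open>from_nat_into T\<close>
    returns a default value.\<close>
  define P where "P j \<nu> \<longleftrightarrow> (\<forall>a\<in>(from_nat_into T) ` {..j} \<inter> T. \<exists>y\<in>eps_argmin (1 / real (Suc j)) (\<psi>s \<nu>).
      dist y a < 1 / real (Suc j))" for j \<nu>
  have "\<forall>\<^sub>F \<nu> in sequentially. P j \<nu>" for j
    unfolding P_def
  proof (rule eventually_ball_finite)
    show "\<forall>a\<in>from_nat_into T ` {..j} \<inter> T. \<forall>\<^sub>F \<nu> in sequentially.
        \<exists>y\<in>eps_argmin (1 / real (Suc j)) (\<psi>s \<nu>). dist y a < 1 / real (Suc j)"
    proof
      fix a
      assume "a \<in> from_nat_into T ` {..j} \<inter> T"
      then obtain w where w: "w \<longlonglongrightarrow> a"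
          "\<And>\<delta>. \<delta> > 0 \<Longrightarrow> \<forall>\<^sub>F \<nu> in sequentially. w \<nu> \<in> eps_argmin \<delta> (\<psi>s \<nu>)"
        using recovery_in_eps_argmin[OF lim] T by (metis IntE subsetD)
      show "\<forall>\<^sub>F \<nu> in sequentially. \<exists>y\<in>eps_argmin (1 / real (Suc j)) (\<psi>s \<nu>). dist y a < 1 / real (Suc j)"
        using w(2)[of "1 / real (Suc j)"] tendstoD[OF w(1), of "1 / real (Suc j)"]
        by (auto elim: eventually_elim2)
    qed
  qed auto
  then obtain k where k: "filterlim k at_top sequentially" "\<forall>\<^sub>F \<nu> in sequentially. P (k \<nu>) \<nu>"
    using diagonal_index by blast
  \<comment> \<open>The same number serves as tolerance and as approximation radius in
    \<open>P\<close>.\<close>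
  define \<epsilon>s where "\<epsilon>s \<nu> = 1 / real (Suc (k \<nu>))" for \<nu>
  have eps: "\<epsilon>s \<longlonglongrightarrow> 0"
    using filterlim_compose[OF LIMSEQ_inverse_real_of_nat k(1)] by (simp add: divide_inverse \<epsilon>s_def[abs_def])
  let ?C = "\<lambda>\<nu>. eps_argmin (\<epsilon>s \<nu>) (\<psi>s \<nu>)"
  have "argmin_set \<psi> \<subseteq> LimInn ?C"
  proof
    fix z
    assume z: "z \<in> argmin_set \<psi>"
    show "z \<in> LimInn ?C"
      unfolding LimInn_iff
    proof (intro allI impI)
      fix \<delta> :: real
      assume "\<delta> > 0"
      then obtain a where a: "a \<in> T" "dist a z < \<delta> / 2"
        using z T(3) by (metis closure_approachable half_gt_zero subsetD)
      then obtain i where i: "a = from_nat_into T i"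
        using T(1) by (metis from_nat_into_surj)
      have "\<forall>\<^sub>F \<nu> in sequentially. i \<le> k \<nu>"
        using k(1) by (simp add: filterlim_at_top)
      moreover have "\<forall>\<^sub>F \<nu> in sequentially. \<epsilon>s \<nu> < \<delta> / 2"
        using order_tendstoD(2)[OF eps, of "\<delta> / 2"] \<open>\<delta> > 0\<close> by simp
      ultimately show "\<forall>\<^sub>F \<nu> in sequentially. \<exists>y\<in>?C \<nu>. dist y z < \<delta>"
        using k(2)
      proof eventually_elim
        case (elim \<nu>)
        have "a \<in> from_nat_into T ` {..k \<nu>} \<inter> T"
          using elim(1) i a(1) by auto
        then obtain y where "y \<in> ?C \<nu>" "dist y a < \<epsilon>s \<nu>"
          using elim(3) by (auto simp: P_def \<epsilon>s_def)
        moreover have "dist y z \<le> dist y a + dist a z"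
          by (rule dist_triangle)
        ultimately show ?case
          using elim(2) a(2) by (intro bexI[of _ y]) auto
      qed
    qed
  qed
  moreover have "LimOut ?C \<subseteq> argmin_set \<psi>"
  proof -
    \<comment> \<open>The outer limit is controlled by the limiting tolerance 0, which leaves exact
      minimizers only.\<close>
    have "eps_argmin 0 \<psi> \<subseteq> argmin_set \<psi>"
    proof
      fix z
      assume "z \<in> eps_argmin 0 \<psi>"
      then show "z \<in> argmin_set \<psi>"
        using m_le[of z] by (simp add: eps_argmin_def argmin_set_def INF_eq)
    qed
    with LimOut_eps_argmin_subset[OF eps] show ?thesis
      by blast
  qed
  ultimately have "set_converges ?C (argmin_set \<psi>)"
    using LimInn_subset_LimOut[of ?C] unfolding set_converges_def by blast
  moreover have "0 \<le> \<epsilon>s \<nu>" for \<nu>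
    by (simp add: \<epsilon>s_def)
  ultimately show thesis
    using that eps by blast
qed

end

lemma lsc_le_Liminf:
  assumes "lsc \<psi>" "(w \<longlongrightarrow> z) F"
  shows "\<psi> z \<le> Liminf F (\<lambda>\<nu>. \<psi> (w \<nu>))"
  unfolding le_Liminf_iff
proof (intro allI impI)
  fix c
  assume "c < \<psi> z"
  also have "\<dots> \<le> Liminf (nhds z) \<psi>"
    using assms(1) by (auto simp: lsc_def)
  finally have "\<forall>\<^sub>F y in nhds z. c < \<psi> y"
    by (rule less_LiminfD)
  then show "\<forall>\<^sub>F \<nu> in F. c < \<psi> (w \<nu>)"
    using assms(2) by (auto simp: filterlim_iff)
qed

section \<open>Expectations of random lsc functions\<close>

lemma random_lsc_borel_measurable:
  fixes g :: "'a::topological_space \<Rightarrow> 'b::metric_space \<Rightarrow> real"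
  assumes "random_lsc \<Xi> (\<lambda>\<xi> x. ereal (g \<xi> x))"
  shows "(\<lambda>\<xi>. g \<xi> x) \<in> borel_measurable (restrict_space borel \<Xi>)"
  unfolding borel_measurable_iff_le
proof
  fix t
  let ?M = "restrict_space borel \<Xi> :: 'a measure"
  let ?epi = "\<lambda>\<xi>. epigraph (\<lambda>x. ereal (g \<xi> x))"
  \<comment> \<open>\<open>{x} \<times> {..t}\<close> is not open; closedness of the epigraph lets the open sets \<open>U k\<close> detect it.\<close>
  define U where "U k = ball x (1 / real (Suc k)) \<times> {..<t + 1 / real (Suc k)}" for k
  have lim: "(\<lambda>k. 1 / real (Suc k)) \<longlonglongrightarrow> 0"
    using LIMSEQ_inverse_real_of_nat by (simp add: divide_inverse)
  have "g \<xi> x \<le> t \<longleftrightarrow> (\<forall>k. ?epi \<xi> \<inter> U k \<noteq> {})" if "\<xi> \<in> \<Xi>" for \<xi>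
  proof
    assume "g \<xi> x \<le> t"
    then have "(x, t) \<in> ?epi \<xi> \<inter> U k" for k
      by (auto simp: epigraph_def U_def)
    then show "\<forall>k. ?epi \<xi> \<inter> U k \<noteq> {}"
      by blast
  next
    assume "\<forall>k. ?epi \<xi> \<inter> U k \<noteq> {}"
    then have "\<forall>k. \<exists>y. y \<in> ?epi \<xi> \<inter> U k"
      by blast
    then obtain p where p: "\<And>k. p k \<in> ?epi \<xi> \<inter> U k"
      by metis
    \<comment> \<open>The heights of \<open>p k\<close> are bounded above but may fail to converge.
      Raising them to \<open>t + 1 / (k + 1)\<close> stays in the epigraph and forces convergence to
      \<open>(x, t)\<close>.\<close>
    define q where "q k = (fst (p k), t + 1 / real (Suc k))" for k
    have "q k \<in> ?epi \<xi>" for k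
      using p[of k] by (auto simp: q_def U_def epigraph_def split: prod.splits)
    moreover have "(\<lambda>k. dist (fst (p k)) x) \<longlonglongrightarrow> 0"
    proof (rule Lim_null_comparison[OF _ lim], rule always_eventually, rule allI)
      show "norm (dist (fst (p k)) x) \<le> 1 / real (Suc k)" for k
        using p[of k] by (auto simp: U_def dist_commute)
    qed
    then have "(\<lambda>k. fst (p k)) \<longlonglongrightarrow> x"
      by (rule iffD2[OF tendsto_dist_iff])
    then have "q \<longlonglongrightarrow> (x, t + 0)"
      unfolding q_def[abs_def] by (intro tendsto_intros lim)
    moreover have "closed (?epi \<xi>)"
      using assms that by (auto simp: random_lsc_def)
    ultimately have "(x, t + 0) \<in> ?epi \<xi>"
      by (metis closed_sequentially)
    then show "g \<xi> x \<le> t"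
      by (simp add: epigraph_def)
  qed
  then have "{\<xi> \<in> space ?M. g \<xi> x \<le> t} = (\<Inter>k. {\<xi>\<in>\<Xi>. ?epi \<xi> \<inter> U k \<noteq> {}})"
    by (auto simp: space_restrict_space)
  also have "\<dots> \<in> sets ?M"
  proof (rule sets.countable_INT[OF _ UNIV_not_empty])
    have "open (U k)" for k
      by (auto simp: U_def intro: open_Times)
    then show "range (\<lambda>k. {\<xi>\<in>\<Xi>. ?epi \<xi> \<inter> U k \<noteq> {}}) \<subseteq> sets ?M"
      using assms by (auto simp: random_lsc_def)
  qed
  finally show "{\<xi> \<in> space ?M. g \<xi> x \<le> t} \<in> sets ?M" .
qed

text \<open>A point strictly below the graph lies in the complement of the epigraph, which is
  open.\<close>

lemma random_lsc_eventually_gt: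
  fixes g :: "'a::topological_space \<Rightarrow> 'b::metric_space \<Rightarrow> real"
  assumes "random_lsc \<Xi> (\<lambda>\<xi> x. ereal (g \<xi> x))" "\<xi> \<in> \<Xi>" "(X \<longlongrightarrow> x) F" "c < g \<xi> x"
  shows "\<forall>\<^sub>F k in F. c < g \<xi> (X k)"
proof -
  let ?epi = "epigraph (\<lambda>x. ereal (g \<xi> x))"
  have "((\<lambda>k. (X k, c)) \<longlongrightarrow> (x, c)) F"
    using assms(3) by (intro tendsto_intros)
  moreover have "open (- ?epi)"
    using assms(1,2) by (auto simp: random_lsc_def)
  moreover have "(x, c) \<in> - ?epi"
    using assms(4) by (auto simp: epigraph_def)
  ultimately have "\<forall>\<^sub>F k in F. (X k, c) \<in> - ?epi"
    by (rule topological_tendstoD)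
  then show ?thesis
    by eventually_elim (auto simp: epigraph_def)
qed

lemma prob_measuresD:
  assumes "\<mu> \<in> prob_measures \<Xi>"
  shows "finite_measure \<mu>" "measure \<mu> (space \<mu>) = 1" "sets \<mu> = sets (restrict_space borel \<Xi>)" "space \<mu> = \<Xi>"
proof -
  show s: "sets \<mu> = sets (restrict_space borel \<Xi>)"
    using assms by (simp add: prob_measures_def)
  show "space \<mu> = \<Xi>"
    using sets_eq_imp_space_eq[OF s] by (simp add: space_restrict_space)
  show "finite_measure \<mu>"
    using assms by (auto simp: prob_measures_def intro: finite_measureI)
  show "measure \<mu> (space \<mu>) = 1"
    using assms by (simp add: prob_measures_def measure_def)
qed

locale bounded_random_lsc =
  fixes \<Xi> :: "'a::topological_space set" and g :: "'a \<Rightarrow> 'b::real_normed_vector \<Rightarrow> real"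
    and \<mu> :: "'a measure"
  assumes prob: "\<mu> \<in> prob_measures \<Xi>"
    and lsc: "random_lsc \<Xi> (\<lambda>\<xi> x. ereal (g \<xi> x))"
    and bdd: "locally_uniformly_bounded \<Xi> g"
begin

lemma measurable: "(\<lambda>\<xi>. g \<xi> x) \<in> borel_measurable \<mu>"
  using random_lsc_borel_measurable[OF lsc, of x] measurable_cong_sets[OF prob_measuresD(3)[OF prob] refl]
  by blast

lemma integrable: "integrable \<mu> (\<lambda>\<xi>. g \<xi> x)"
proof -
  interpret finite_measure \<mu>
    by (rule prob_measuresD(1)[OF prob])
  obtain \<epsilon> M where "\<epsilon> > 0" and M: "\<forall>\<xi>\<in>\<Xi>. \<forall>y. norm (y - x) \<le> \<epsilon> \<longrightarrow> \<bar>g \<xi> y\<bar> \<le> M"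
    using bdd unfolding locally_uniformly_bounded_def by meson
  then have "\<bar>g \<xi> x\<bar> \<le> M" if "\<xi> \<in> \<Xi>" for \<xi>
    using that by simp
  then show ?thesis
    using prob_measuresD(4)[OF prob] by (intro integrable_const_bound[of _ M] measurable) auto
qed

text \<open>Fatou's lemma, after adding the local bound \<open>M\<close> to make the integrands
  nonnegative. That bound holds within \<open>\<epsilon>\<close> of \<open>x\<close>, where
  \<open>X k\<close> eventually stays.\<close>

lemma integral_eventually_gt:
  assumes X: "X \<longlonglongrightarrow> x" and c: "c < (\<integral>\<xi>. g \<xi> x \<partial>\<mu>)"
  shows "\<forall>\<^sub>F k in sequentially. c < (\<integral>\<xi>. g \<xi> (X k) \<partial>\<mu>)"
proof -
  interpret finite_measure \<mu>
    by (rule prob_measuresD(1)[OF prob])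
  obtain \<epsilon> M where "\<epsilon> > 0" and M: "\<And>\<xi> y. \<xi> \<in> \<Xi> \<Longrightarrow> norm (y - x) \<le> \<epsilon> \<Longrightarrow> \<bar>g \<xi> y\<bar> \<le> M"
    using bdd unfolding locally_uniformly_bounded_def by metis
  let ?I = "\<lambda>y. \<integral>\<xi>. g \<xi> y \<partial>\<mu>" and ?J = "\<lambda>y. \<integral>\<^sup>+\<xi>. ennreal (g \<xi> y + M) \<partial>\<mu>"
  have J: "?J y = ennreal (?I y + M)" "?I y + M \<ge> 0" if "norm (y - x) \<le> \<epsilon>" for y
  proof -
    have nonneg: "AE \<xi> in \<mu>. 0 \<le> g \<xi> y + M"
      using M[OF _ that] prob_measuresD(4)[OF prob] by (intro AE_I2) (smt (verit))
    have "?J y = ennreal (\<integral>\<xi>. g \<xi> y + M \<partial>\<mu>)"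
      using nonneg by (intro nn_integral_eq_integral Bochner_Integration.integrable_add integrable) auto
    moreover have I: "(\<integral>\<xi>. g \<xi> y + M \<partial>\<mu>) = ?I y + M"
      by (subst Bochner_Integration.integral_add) (auto intro: integrable simp: prob_measuresD(2)[OF prob])
    ultimately show "?J y = ennreal (?I y + M)"
      by simp
    show "?I y + M \<ge> 0"
      using integral_nonneg_AE[OF nonneg] I by simp
  qed
  have near: "\<forall>\<^sub>F k in sequentially. norm (X k - x) \<le> \<epsilon>"
    using tendstoD[OF X \<open>\<epsilon> > 0\<close>] by eventually_elim (simp add: dist_norm)
  show ?thesis
  \<comment> \<open>\<open>ennreal\<close> truncates negative reals to 0, so strict comparison with
    \<open>c + M\<close> passes through it only if \<open>c + M\<close> is nonnegative. Otherwise
    nonnegativity of the shifted integral is enough.\<close>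
  proof (cases "c + M < 0")
    case True
    from near show ?thesis
    proof eventually_elim
      case (elim k)
      show ?case
        using J(2)[OF elim] True by linarith
    qed
  next
    case False
    have "ennreal (c + M) < ennreal (?I x + M)"
      using c False by (intro ennreal_lessI) auto
    also have "\<dots> = ?J x"
      using J(1)[of x] \<open>\<epsilon> > 0\<close> by simp
    also have "\<dots> \<le> (\<integral>\<^sup>+\<xi>. liminf (\<lambda>k. ennreal (g \<xi> (X k) + M)) \<partial>\<mu>)"
    proof (rule nn_integral_mono)
      fix \<xi>
      assume "\<xi> \<in> space \<mu>"
      then have \<xi>: "\<xi> \<in> \<Xi>"
        using prob_measuresD(4)[OF prob] by simp
      show "ennreal (g \<xi> x + M) \<le> liminf (\<lambda>k. ennreal (g \<xi> (X k) + M))"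
        unfolding le_Liminf_iff
      proof (intro allI impI)
        fix b
        assume b: "b < ennreal (g \<xi> x + M)"
        then obtain r where r: "b = ennreal r" "r \<ge> 0"
          by (cases b) auto
        then have "r - M < g \<xi> x"
          using b by (auto simp: ennreal_less_iff)
        then have "\<forall>\<^sub>F k in sequentially. r - M < g \<xi> (X k)"
          by (rule random_lsc_eventually_gt[OF lsc \<xi> X])
        then show "\<forall>\<^sub>F k in sequentially. b < ennreal (g \<xi> (X k) + M)"
          by eventually_elim (use r in \<open>auto simp: ennreal_less_iff\<close>)
      qed
    qed
    also have "\<dots> \<le> liminf (\<lambda>k. ?J (X k))"
      using measurable by (intro nn_integral_liminf) simp
    finally have "\<forall>\<^sub>F k in sequentially. ennreal (c + M) < ?J (X k)"
      by (rule less_LiminfD)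
    with near show ?thesis
    proof eventually_elim
      case (elim k)
      have "ennreal (c + M) < ennreal (?I (X k) + M)"
        using elim(2) J(1)[OF elim(1)] by simp
      then show ?case
        using False by (simp add: ennreal_less_iff)
    qed
  qed
qed

end

section \<open>Vector-valued integrals and the minimal information metric\<close>

lemma integrable_vec:
  fixes f :: "'a \<Rightarrow> real^'m"
  assumes "\<And>i. integrable M (\<lambda>x. f x $ i)"
  shows "integrable M f"
proof -
  have "integrable M (\<lambda>x. \<Sum>i\<in>UNIV. f x $ i *\<^sub>R axis i (1::real))"
    using assms by (intro Bochner_Integration.integrable_sum integrable_scaleR_left)
  then show ?thesis
    by (simp add: scaleR_conv_of_real scalar_mult_eq_scaleR[symmetric] basis_expansion)
qed

lemma integral_vec_nth:
  fixes f :: "'a \<Rightarrow> real^'m"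
  assumes "\<And>i. integrable M (\<lambda>x. f x $ i)"
  shows "(\<integral>x. f x \<partial>M) $ i = (\<integral>x. f x $ i \<partial>M)"
  by (rule integral_bounded_linear[OF bounded_linear_vec_nth integrable_vec[OF assms], symmetric])

lemma mi_measures_bounded:
  assumes "\<mu> \<in> mi_measures \<Xi> g\<^sub>0 G"
  obtains B where "\<And>x i. x \<in> effdom g\<^sub>0 \<Longrightarrow> \<bar>\<integral>\<xi>. G \<xi> x $ i \<partial>\<mu>\<bar> \<le> B"
proof -
  let ?S = "SUP x\<in>effdom g\<^sub>0. MAX i\<in>UNIV. ereal \<bar>\<integral>\<xi>. G \<xi> x $ i \<partial>\<mu>\<bar>"
  have "?S < \<infinity>"
    using assms by (simp add: mi_measures_def)
  \<comment> \<open>The supremum is \<open>-\<infinity>\<close> when \<open>effdom g\<^sub>0\<close>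
    is empty, so only an upper bound is extracted.\<close>
  then obtain B where B: "?S \<le> ereal B"
    by (cases ?S) auto
  have "\<bar>\<integral>\<xi>. G \<xi> x $ i \<partial>\<mu>\<bar> \<le> B" if "x \<in> effdom g\<^sub>0" for x i
  proof -
    have "ereal \<bar>\<integral>\<xi>. G \<xi> x $ i \<partial>\<mu>\<bar> \<le> (MAX i\<in>UNIV. ereal \<bar>\<integral>\<xi>. G \<xi> x $ i \<partial>\<mu>\<bar>)"
      by (intro Max_ge) auto
    also have "\<dots> \<le> ?S"
      using that by (rule SUP_upper)
    also note B
    finally show ?thesis
      by simp
  qed
  then show thesis
    by (rule that)
qed

text \<open>A real supremum dominates its members when they are bounded above. Membership of both
  measures in \<open>mi_measures\<close> supplies such a bound.\<close>

lemma le_d_mi: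
  assumes "\<mu>\<^sub>1 \<in> mi_measures \<Xi> g\<^sub>0 G" "\<mu>\<^sub>2 \<in> mi_measures \<Xi> g\<^sub>0 G" "x \<in> effdom g\<^sub>0"
  shows "\<bar>(\<integral>\<xi>. G \<xi> x $ i \<partial>\<mu>\<^sub>1) - (\<integral>\<xi>. G \<xi> x $ i \<partial>\<mu>\<^sub>2)\<bar> \<le> d_mi g\<^sub>0 G \<mu>\<^sub>1 \<mu>\<^sub>2"
proof -
  let ?D = "\<lambda>x i. \<bar>(\<integral>\<xi>. G \<xi> x $ i \<partial>\<mu>\<^sub>1) - (\<integral>\<xi>. G \<xi> x $ i \<partial>\<mu>\<^sub>2)\<bar>"
  obtain B1 B2 where B1: "\<And>x i. x \<in> effdom g\<^sub>0 \<Longrightarrow> \<bar>\<integral>\<xi>. G \<xi> x $ i \<partial>\<mu>\<^sub>1\<bar> \<le> B1"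
    and B2: "\<And>x i. x \<in> effdom g\<^sub>0 \<Longrightarrow> \<bar>\<integral>\<xi>. G \<xi> x $ i \<partial>\<mu>\<^sub>2\<bar> \<le> B2"
    using mi_measures_bounded assms(1,2) by metis
  have "?D y j \<le> B1 + B2" if "y \<in> effdom g\<^sub>0" for y j
    using B1[OF that, of j] B2[OF that, of j] by linarith
  then have "bdd_above ((\<lambda>x. MAX i\<in>UNIV. ?D x i) ` effdom g\<^sub>0)"
    by (intro bdd_aboveI[of _ "B1 + B2"]) auto
  moreover have "?D x i \<le> (MAX i\<in>UNIV. ?D x i)"
    by (intro Max_ge) auto
  ultimately show ?thesis
    unfolding d_mi_def using assms(3) by (intro cSUP_upper2)
qed

section \<open>Epi-convergence of the relaxed problems\<close>

text \<open>The measures are abstracted to their mean maps \<open>e\<close> and \<open>es\<close>: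
  what counts is componentwise lower semicontinuity of \<open>e\<close> and a distance between the
  maps that is uniform on \<open>effdom g\<^sub>0\<close>.\<close>

lemma epi_converges_relaxation:
  fixes g\<^sub>0 :: "'b::topological_space \<Rightarrow> ereal" and h :: "real^'m \<Rightarrow> ereal"
    and e :: "'b \<Rightarrow> real^'m" and es :: "nat \<Rightarrow> 'b \<Rightarrow> real^'m"
  assumes g0: "proper_fun g\<^sub>0" "lsc g\<^sub>0"
    and h: "proper_fun h" "lsc h" "mono h"
    and e_lsc: "\<And>X x c i. X \<longlonglongrightarrow> x \<Longrightarrow> c < e x $ i \<Longrightarrow> \<forall>\<^sub>F \<nu> in sequentially. c < e (X \<nu>) $ i"
    and close: "\<And>\<nu> x i. x \<in> effdom g\<^sub>0 \<Longrightarrow> \<bar>es \<nu> x $ i - e x $ i\<bar> \<le> d \<nu>"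
    and d: "d \<longlonglongrightarrow> 0"
    and alpha: "\<alpha> \<ge> 1"
    and lambda: "\<And>\<nu>. lam \<nu> > 0" "lam \<longlonglongrightarrow> 0" "(\<lambda>\<nu>. 1 / lam \<nu> * d \<nu> powr \<alpha>) \<longlonglongrightarrow> 0"
  shows "epi_converges
    (\<lambda>\<nu> (u, x). g\<^sub>0 x + h (u + es \<nu> x) + ereal (1 / (\<alpha> * lam \<nu>) * norm u powr \<alpha>))
    (\<lambda>(u, x). g\<^sub>0 x + h (u + e x) + indicator_fun {0} u)"
    (is "epi_converges ?fs ?f")
proof -
  have g0_ninf: "g\<^sub>0 x \<noteq> -\<infinity>" and h_ninf: "h y \<noteq> -\<infinity>" for x y
    using g0(1) h(1) by (simp_all add: proper_fun_def)
  have d_nonneg: "d \<nu> \<ge> 0" for \<nu>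
  proof -
    obtain x where "x \<in> effdom g\<^sub>0"
      using g0(1) by (auto simp: proper_fun_def effdom_def)
    from close[OF this] show ?thesis
      by (meson abs_ge_zero order_trans)
  qed
  define pen where "pen \<nu> u = 1 / (\<alpha> * lam \<nu>) * norm u powr \<alpha>" for \<nu> and u :: "real^'m"
  have pen_nonneg: "pen \<nu> u \<ge> 0" for \<nu> u
    using alpha lambda(1)[of \<nu>] by (simp add: pen_def)
  \<comment> \<open>At \<open>u = 0\<close> nonnegativity of the penalty suffices. Otherwise its
    coefficient tends to infinity while \<open>norm (us \<nu>) powr \<alpha>\<close> keeps a
    positive limit.\<close>
  have pen_liminf: "indicator_fun {0} u \<le> liminf (\<lambda>\<nu>. ereal (pen \<nu> (us \<nu>)))" if us: "us \<longlonglongrightarrow> u" for us u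
  proof (cases "u = 0")
    case True
    then show ?thesis
      using pen_nonneg by (auto simp: indicator_fun_def intro!: Liminf_bounded always_eventually)
  next
    case False
    have "(\<lambda>\<nu>. \<alpha> * lam \<nu>) \<longlonglongrightarrow> 0"
      using tendsto_mult[OF tendsto_const[of \<alpha>] lambda(2)] by simp
    moreover have "\<forall>\<^sub>F \<nu> in sequentially. 0 < \<alpha> * lam \<nu>"
      using alpha lambda(1) by (intro always_eventually allI mult_pos_pos) auto
    ultimately have "LIM \<nu> sequentially. inverse (\<alpha> * lam \<nu>) :> at_top"
      by (rule filterlim_inverse_at_top)
    moreover have "(\<lambda>\<nu>. norm (us \<nu>) powr \<alpha>) \<longlonglongrightarrow> norm u powr \<alpha>"
      using False by (intro tendsto_powr tendsto_norm us tendsto_const) auto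
    moreover have "norm u powr \<alpha> > 0"
      using False by simp
    ultimately have "LIM \<nu> sequentially. norm (us \<nu>) powr \<alpha> * inverse (\<alpha> * lam \<nu>) :> at_top"
      by (intro filterlim_tendsto_pos_mult_at_top)
    then have "LIM \<nu> sequentially. pen \<nu> (us \<nu>) :> at_top"
      by (simp add: pen_def divide_inverse mult.commute)
    then have "(\<lambda>\<nu>. ereal (pen \<nu> (us \<nu>))) \<longlonglongrightarrow> \<infinity>"
      by (simp add: tendsto_PInfty_eq_at_top)
    then have "liminf (\<lambda>\<nu>. ereal (pen \<nu> (us \<nu>))) = \<infinity>"
      by (intro lim_imp_Liminf) auto
    then show ?thesis
      by simp
  qed
  have lower: "?f z \<le> liminf (\<lambda>\<nu>. ?fs \<nu> (w \<nu>))" if w: "w \<longlonglongrightarrow> z" for w z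
  proof -
    obtain u x where z: "z = (u, x)"
      by (cases z)
    define us xs where "us \<nu> = fst (w \<nu>)" and "xs \<nu> = snd (w \<nu>)" for \<nu>
    have us: "us \<longlonglongrightarrow> u" and xs: "xs \<longlonglongrightarrow> x"
      using tendsto_fst[OF w] tendsto_snd[OF w] by (simp_all add: us_def[abs_def] xs_def[abs_def] z)
    \<comment> \<open>Lower semicontinuity of \<open>e\<close> allows \<open>e (xs \<nu>)\<close> to
      stay far above \<open>e x\<close>. Capping at the expected limit turns this one-sided control
      into convergence.\<close>
    define ys where "ys \<nu> = (\<chi> i. min ((u + e x) $ i) (us \<nu> $ i - d \<nu> + e (xs \<nu>) $ i))" for \<nu>
    have "ys \<longlonglongrightarrow> u + e x"
    proof (rule vec_tendstoI, rule order_tendstoI)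
      fix i c
      assume c: "c < (u + e x) $ i"
      define \<delta> where "\<delta> = ((u + e x) $ i - c) / 2"
      have \<delta>: "\<delta> > 0" "u $ i - \<delta> + (e x $ i - \<delta>) = c"
        using c by (auto simp: \<delta>_def)
      have "(\<lambda>\<nu>. us \<nu> $ i - d \<nu>) \<longlonglongrightarrow> u $ i - 0"
        by (intro tendsto_intros us d)
      then have "\<forall>\<^sub>F \<nu> in sequentially. u $ i - \<delta> < us \<nu> $ i - d \<nu>"
        using \<delta> by (intro order_tendstoD(1)) auto
      moreover have "\<forall>\<^sub>F \<nu> in sequentially. e x $ i - \<delta> < e (xs \<nu>) $ i"
        using \<delta> by (intro e_lsc[OF xs]) auto
      ultimately show "\<forall>\<^sub>F \<nu> in sequentially. c < ys \<nu> $ i"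
      proof eventually_elim
        case (elim \<nu>)
        then have "c < us \<nu> $ i - d \<nu> + e (xs \<nu>) $ i"
          using \<delta>(2) by linarith
        then show ?case
          using c by (simp add: ys_def)
      qed
    next
      fix i c
      assume "(u + e x) $ i < c"
      then show "\<forall>\<^sub>F \<nu> in sequentially. ys \<nu> $ i < c"
        by (intro always_eventually) (auto simp: ys_def)
    qed
    then have h_le: "h (u + e x) \<le> liminf (\<lambda>\<nu>. h (ys \<nu>))"
      by (rule lsc_le_Liminf[OF h(2)])
    have g_le: "g\<^sub>0 x \<le> liminf (\<lambda>\<nu>. g\<^sub>0 (xs \<nu>))"
      by (rule lsc_le_Liminf[OF g0(2) xs])
    \<comment> \<open>Superadditivity of liminf fails for sums of opposite infinities; these are
      excluded since both lower limits dominate values other than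
      \<open>-\<infinity>\<close>.\<close>
    have ninf: "liminf (\<lambda>\<nu>. g\<^sub>0 (xs \<nu>)) \<noteq> -\<infinity>" "liminf (\<lambda>\<nu>. h (ys \<nu>)) \<noteq> -\<infinity>"
      using g_le h_le g0_ninf[of x] h_ninf[of "u + e x"] by auto
    have "?f z \<le> liminf (\<lambda>\<nu>. g\<^sub>0 (xs \<nu>)) + liminf (\<lambda>\<nu>. h (ys \<nu>)) + liminf (\<lambda>\<nu>. ereal (pen \<nu> (us \<nu>)))"
      unfolding z prod.case by (intro add_mono g_le h_le pen_liminf us)
    also have "\<dots> \<le> liminf (\<lambda>\<nu>. g\<^sub>0 (xs \<nu>) + h (ys \<nu>)) + liminf (\<lambda>\<nu>. ereal (pen \<nu> (us \<nu>)))"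
      using ninf by (intro add_right_mono ereal_liminf_add_mono) auto
    also have "\<dots> \<le> liminf (\<lambda>\<nu>. g\<^sub>0 (xs \<nu>) + h (ys \<nu>) + ereal (pen \<nu> (us \<nu>)))"
    proof (rule ereal_liminf_add_mono)
      have "liminf (\<lambda>\<nu>. g\<^sub>0 (xs \<nu>)) + liminf (\<lambda>\<nu>. h (ys \<nu>)) \<le> liminf (\<lambda>\<nu>. g\<^sub>0 (xs \<nu>) + h (ys \<nu>))"
        using ninf by (intro ereal_liminf_add_mono) auto
      moreover have "liminf (\<lambda>\<nu>. g\<^sub>0 (xs \<nu>)) + liminf (\<lambda>\<nu>. h (ys \<nu>)) \<noteq> -\<infinity>"
        using ninf by auto
      ultimately have 1: "liminf (\<lambda>\<nu>. g\<^sub>0 (xs \<nu>) + h (ys \<nu>)) \<noteq> -\<infinity>"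
        by auto
      have 2: "liminf (\<lambda>\<nu>. ereal (pen \<nu> (us \<nu>))) \<noteq> -\<infinity>"
        using pen_liminf[OF us] by (auto simp: indicator_fun_def split: if_splits)
      from 1 2 show "\<not> (liminf (\<lambda>\<nu>. g\<^sub>0 (xs \<nu>) + h (ys \<nu>)) = \<infinity> \<and> liminf (\<lambda>\<nu>. ereal (pen \<nu> (us \<nu>))) = -\<infinity>
          \<or> liminf (\<lambda>\<nu>. g\<^sub>0 (xs \<nu>) + h (ys \<nu>)) = -\<infinity> \<and> liminf (\<lambda>\<nu>. ereal (pen \<nu> (us \<nu>))) = \<infinity>)"
        by blast
    qed
    also have "\<dots> \<le> liminf (\<lambda>\<nu>. ?fs \<nu> (w \<nu>))"
    proof (intro Liminf_mono always_eventually allI)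
      fix \<nu>
      have fs: "?fs \<nu> (w \<nu>) = g\<^sub>0 (xs \<nu>) + h (us \<nu> + es \<nu> (xs \<nu>)) + ereal (pen \<nu> (us \<nu>))"
        by (simp add: us_def xs_def pen_def split_beta)
      show "g\<^sub>0 (xs \<nu>) + h (ys \<nu>) + ereal (pen \<nu> (us \<nu>)) \<le> ?fs \<nu> (w \<nu>)"
      \<comment> \<open>The estimate \<open>close\<close> is available only on
        \<open>effdom g\<^sub>0\<close>; elsewhere \<open>g\<^sub>0\<close> and hence the right-hand
        side is infinite.\<close>
      proof (cases "xs \<nu> \<in> effdom g\<^sub>0")
        case True
        have "ys \<nu> \<le> us \<nu> + es \<nu> (xs \<nu>)"
          unfolding less_eq_vec_def
        proof
          fix i
          have "\<bar>es \<nu> (xs \<nu>) $ i - e (xs \<nu>) $ i\<bar> \<le> d \<nu>"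
            by (rule close[OF True])
          then show "ys \<nu> $ i \<le> (us \<nu> + es \<nu> (xs \<nu>)) $ i"
            by (auto simp: ys_def min_def)
        qed
        then have "h (ys \<nu>) \<le> h (us \<nu> + es \<nu> (xs \<nu>))"
          by (rule monoD[OF h(3)])
        then show ?thesis
          unfolding fs by (intro add_right_mono add_left_mono)
      next
        case False
        then show ?thesis
          unfolding fs by (simp add: effdom_def)
      qed
    qed
    finally show ?thesis .
  qed
  have upper: "\<exists>w. w \<longlonglongrightarrow> z \<and> limsup (\<lambda>\<nu>. ?fs \<nu> (w \<nu>)) \<le> ?f z" for z
  proof (cases "?f z = \<infinity>")
    case True
    then show ?thesis
      by (intro exI[of _ "\<lambda>_. z"]) auto
  next
    case False
    then obtain x where z: "z = (0, x)" and fin: "g\<^sub>0 x + h (e x) \<noteq> \<infinity>"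
      using g0_ninf h_ninf by (cases z) (auto simp: indicator_fun_def split: if_splits)
    have x: "x \<in> effdom g\<^sub>0"
      using fin h_ninf by (auto simp: effdom_def)
    define us where "us \<nu> = e x - es \<nu> x" for \<nu>
    \<comment> \<open>The metric controls single components; the factor \<open>CARD('m)\<close>
      comes from bounding the Euclidean norm by the sum of their absolute values.\<close>
    have norm_us: "norm (us \<nu>) \<le> real CARD('m) * d \<nu>" for \<nu>
    proof -
      have "norm (us \<nu>) \<le> (\<Sum>i\<in>UNIV. \<bar>us \<nu> $ i\<bar>)"
        by (rule norm_le_l1_cart)
      also have "\<dots> \<le> (\<Sum>i\<in>(UNIV::'m set). d \<nu>)"
        using close[OF x, of \<nu>] by (intro sum_mono) (simp add: us_def abs_minus_commute)
      finally show ?thesis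
        by simp
    qed
    have us: "us \<longlonglongrightarrow> 0"
      by (rule Lim_null_comparison[of _ "\<lambda>\<nu>. real CARD('m) * d \<nu>"])
        (use norm_us tendsto_mult_right_zero[OF d] in auto)
    have "(\<lambda>\<nu>. pen \<nu> (us \<nu>)) \<longlonglongrightarrow> 0"
    proof (rule Lim_null_comparison)
      show "(\<lambda>\<nu>. real CARD('m) powr \<alpha> / \<alpha> * (1 / lam \<nu> * d \<nu> powr \<alpha>)) \<longlonglongrightarrow> 0"
        by (rule tendsto_mult_right_zero[OF lambda(3)])
      show "\<forall>\<^sub>F \<nu> in sequentially.
          norm (pen \<nu> (us \<nu>)) \<le> real CARD('m) powr \<alpha> / \<alpha> * (1 / lam \<nu> * d \<nu> powr \<alpha>)"
      proof (intro always_eventually allI)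
        fix \<nu>
        have "norm (us \<nu>) powr \<alpha> \<le> (real CARD('m) * d \<nu>) powr \<alpha>"
          using norm_us alpha by (intro powr_mono2) auto
        also have "\<dots> = real CARD('m) powr \<alpha> * d \<nu> powr \<alpha>"
          by (rule powr_mult)
        finally have "pen \<nu> (us \<nu>) \<le> 1 / (\<alpha> * lam \<nu>) * (real CARD('m) powr \<alpha> * d \<nu> powr \<alpha>)"
          unfolding pen_def using alpha lambda(1)[of \<nu>] by (intro mult_left_mono) auto
        then show "norm (pen \<nu> (us \<nu>)) \<le> real CARD('m) powr \<alpha> / \<alpha> * (1 / lam \<nu> * d \<nu> powr \<alpha>)"
          using pen_nonneg by (simp add: field_simps)
      qed
    qed
    then have "(\<lambda>\<nu>. ereal (pen \<nu> (us \<nu>))) \<longlonglongrightarrow> 0"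
      by (simp add: zero_ereal_def)
    moreover have "\<bar>g\<^sub>0 x + h (e x)\<bar> \<noteq> \<infinity>"
      using fin g0_ninf[of x] h_ninf[of "e x"] by (cases "g\<^sub>0 x"; cases "h (e x)") auto
    ultimately have "(\<lambda>\<nu>. g\<^sub>0 x + h (e x) + ereal (pen \<nu> (us \<nu>))) \<longlonglongrightarrow> g\<^sub>0 x + h (e x) + 0"
      by (intro tendsto_add_ereal tendsto_const) auto
    then have "limsup (\<lambda>\<nu>. g\<^sub>0 x + h (e x) + ereal (pen \<nu> (us \<nu>))) = g\<^sub>0 x + h (e x)"
      by (intro lim_imp_Limsup) auto
    \<comment> \<open>Here \<open>us \<nu> + es \<nu> x = e x\<close>, so only the penalty varies
      with \<open>\<nu>\<close>.\<close>
    then have "limsup (\<lambda>\<nu>. ?fs \<nu> (us \<nu>, x)) \<le> ?f z"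
      by (simp add: us_def pen_def z indicator_fun_def)
    moreover have "(\<lambda>\<nu>. (us \<nu>, x)) \<longlonglongrightarrow> z"
      unfolding z by (intro tendsto_intros us)
    ultimately show ?thesis
      by blast
  qed
  show ?thesis
    unfolding epi_converges_def using lower upper by blast
qed

section \<open>From epi-convergence to infima and near-minimizers of the relaxed problems\<close>

theorem proposition3p10:
  fixes \<Xi> :: "(real^'d) set"
    and g\<^sub>0 :: "real^'n \<Rightarrow> ereal"
    and h :: "real^'m \<Rightarrow> ereal"
    and G :: "real^'d \<Rightarrow> real^'n \<Rightarrow> real^'m"
    and \<mu> :: "(real^'d) measure"
    and \<mu>s :: "nat \<Rightarrow> (real^'d) measure"
    and \<alpha> :: real
    and lam :: "nat \<Rightarrow> real"
    and \<phi> :: "real^'n \<Rightarrow> ereal"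
    and f :: "(real^'m) \<times> (real^'n) \<Rightarrow> ereal"
    and fs :: "nat \<Rightarrow> (real^'m) \<times> (real^'n) \<Rightarrow> ereal"
  assumes Xi: "\<Xi> \<noteq> {}" "closed \<Xi>"
    and g0: "proper_fun g\<^sub>0" "lsc g\<^sub>0"
    and h: "proper_fun h" "lsc h" "mono h"
    and G_lsc: "\<And>i. random_lsc \<Xi> (\<lambda>\<xi> x. ereal (G \<xi> x $ i))"
    and G_bdd: "\<And>i. locally_uniformly_bounded \<Xi> (\<lambda>\<xi> x. G \<xi> x $ i)"
    and mu: "\<mu> \<in> mi_measures \<Xi> g\<^sub>0 G" "\<And>\<nu>. \<mu>s \<nu> \<in> mi_measures \<Xi> g\<^sub>0 G"
    and mu_conv: "(\<lambda>\<nu>. d_mi g\<^sub>0 G (\<mu>s \<nu>) \<mu>) \<longlonglongrightarrow> 0"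
    and alpha: "\<alpha> \<ge> 1"
    and lambda: "\<And>\<nu>. lam \<nu> > 0" "lam \<longlonglongrightarrow> 0"
      "(\<lambda>\<nu>. 1 / lam \<nu> * d_mi g\<^sub>0 G (\<mu>s \<nu>) \<mu> powr \<alpha>) \<longlonglongrightarrow> 0"
    and phi_def: "\<phi> = (\<lambda>x. g\<^sub>0 x + h (\<integral>\<xi>. G \<xi> x \<partial>\<mu>))"
    and f_def: "f = (\<lambda>(u, x). g\<^sub>0 x + h (u + (\<integral>\<xi>. G \<xi> x \<partial>\<mu>)) + indicator_fun {0} u)"
    and fs_def: "fs = (\<lambda>\<nu> (u, x). g\<^sub>0 x + h (u + (\<integral>\<xi>. G \<xi> x \<partial>\<mu>s \<nu>))
                        + ereal (1 / (\<alpha> * lam \<nu>) * norm u powr \<alpha>))"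
    and argmin_phi: "argmin_set \<phi> \<noteq> {}"
  shows "epi_converges fs f
    \<and> ((INF z. f z) = (INF x. \<phi> x)
        \<and> (\<forall>\<epsilon>\<ge>0. eps_argmin \<epsilon> f = {0} \<times> eps_argmin \<epsilon> \<phi>))
    \<and> limsup (\<lambda>\<nu>. INF z. fs \<nu> z) \<le> (INF z. f z)
    \<and> (\<forall>\<epsilon>s \<epsilon>. (\<forall>\<nu>. 0 \<le> \<epsilon>s \<nu>) \<and> 0 \<le> \<epsilon> \<and> \<epsilon>s \<longlonglongrightarrow> \<epsilon> \<longrightarrow>
        LimOut (\<lambda>\<nu>. eps_argmin (\<epsilon>s \<nu>) (fs \<nu>)) \<subseteq> eps_argmin \<epsilon> f)
    \<and> (\<forall>\<epsilon>s N u x z. (\<forall>\<nu>. 0 \<le> \<epsilon>s \<nu>) \<and> \<epsilon>s \<longlonglongrightarrow> 0 \<and> infinite N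
        \<and> (\<forall>\<nu>\<in>N. (u \<nu>, x \<nu>) \<in> eps_argmin (\<epsilon>s \<nu>) (fs \<nu>))
        \<and> ((\<lambda>\<nu>. (u \<nu>, x \<nu>)) \<longlongrightarrow> z) (along N) \<longrightarrow>
        ((\<lambda>\<nu>. INF z. fs \<nu> z) \<longlongrightarrow> (INF z. f z)) (along N))
    \<and> ((\<lambda>\<nu>. INF z. fs \<nu> z) \<longlonglongrightarrow> (INF z. f z) \<longleftrightarrow> tight_seq fs)
    \<and> ((\<lambda>\<nu>. INF z. fs \<nu> z) \<longlonglongrightarrow> (INF z. f z) \<longrightarrow>
        (\<forall>x\<^sub>0\<in>argmin_set \<phi>. \<exists>\<epsilon>s. (\<forall>\<nu>. 0 \<le> \<epsilon>s \<nu>) \<and> \<epsilon>s \<longlonglongrightarrow> 0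
          \<and> (0, x\<^sub>0) \<in> LimInn (\<lambda>\<nu>. eps_argmin (\<epsilon>s \<nu>) (fs \<nu>))))
    \<and> ((\<lambda>\<nu>. INF z. fs \<nu> z) \<longlonglongrightarrow> (INF z. f z) \<longrightarrow>
        (\<exists>\<epsilon>s. (\<forall>\<nu>. 0 \<le> \<epsilon>s \<nu>) \<and> \<epsilon>s \<longlonglongrightarrow> 0
          \<and> set_converges (\<lambda>\<nu>. eps_argmin (\<epsilon>s \<nu>) (fs \<nu>)) (argmin_set f)))"
proof -
  define e where "e x = (\<integral>\<xi>. G \<xi> x \<partial>\<mu>)" for x
  define es where "es \<nu> x = (\<integral>\<xi>. G \<xi> x \<partial>\<mu>s \<nu>)" for \<nu> x
  have prob: "\<mu> \<in> prob_measures \<Xi>" "\<mu>s \<nu> \<in> prob_measures \<Xi>" for \<nu>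
    using mu by (simp_all add: mi_measures_def)
  have B: "bounded_random_lsc \<Xi> (\<lambda>\<xi> x. G \<xi> x $ i) \<mu>"
    and Bs: "bounded_random_lsc \<Xi> (\<lambda>\<xi> x. G \<xi> x $ i) (\<mu>s \<nu>)" for i \<nu>
    using prob G_lsc G_bdd by (simp_all add: bounded_random_lsc_def)
  have e_nth: "e x $ i = (\<integral>\<xi>. G \<xi> x $ i \<partial>\<mu>)" for x i
    unfolding e_def by (rule integral_vec_nth[OF bounded_random_lsc.integrable[OF B]])
  have es_nth: "es \<nu> x $ i = (\<integral>\<xi>. G \<xi> x $ i \<partial>\<mu>s \<nu>)" for \<nu> x i
    unfolding es_def by (rule integral_vec_nth[OF bounded_random_lsc.integrable[OF Bs]])
  have epi: "epi_converges fs f"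
    unfolding f_def fs_def e_def[symmetric] es_def[symmetric]
  proof (rule epi_converges_relaxation[OF g0 h _ _ mu_conv alpha lambda])
    show "\<forall>\<^sub>F \<nu> in sequentially. c < e (X \<nu>) $ i" if "X \<longlonglongrightarrow> x" "c < e x $ i" for X x c i
      using that unfolding e_nth by (rule bounded_random_lsc.integral_eventually_gt[OF B])
    show "\<bar>es \<nu> x $ i - e x $ i\<bar> \<le> d_mi g\<^sub>0 G (\<mu>s \<nu>) \<mu>" if "x \<in> effdom g\<^sub>0" for \<nu> x i
      unfolding e_nth es_nth by (rule le_d_mi[OF mu(2) mu(1) that])
  qed
  have ninf: "g\<^sub>0 x \<noteq> -\<infinity>" "h y \<noteq> -\<infinity>" for x y
    using g0(1) h(1) by (simp_all add: proper_fun_def)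
  have f_0: "f (0, x) = \<phi> x" for x
    by (simp add: f_def phi_def indicator_fun_def)
  have f_nz: "f (u, x) = \<infinity>" if "u \<noteq> 0" for u x
    using that ninf by (simp add: f_def indicator_fun_def)
  have INF_f: "(INF z. f z) = (INF x. \<phi> x)"
  proof (rule antisym)
    show "(INF z. f z) \<le> (INF x. \<phi> x)"
      by (rule INF_greatest) (metis INF_lower UNIV_I f_0)
    show "(INF x. \<phi> x) \<le> (INF z. f z)"
    proof (rule INF_greatest)
      fix z
      show "(INF x. \<phi> x) \<le> f z"
        by (cases z; cases "fst z = 0") (auto simp: f_0 f_nz intro: INF_lower)
    qed
  qed
  have eps_f: "eps_argmin \<epsilon> f = {0} \<times> eps_argmin \<epsilon> \<phi>" for \<epsilon>
  proof (rule set_eqI)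
    fix z
    show "z \<in> eps_argmin \<epsilon> f \<longleftrightarrow> z \<in> {0} \<times> eps_argmin \<epsilon> \<phi>"
      by (cases z; cases "fst z = 0") (auto simp: eps_argmin_def effdom_def INF_f f_0 f_nz)
  qed
  have argmin_f: "(0, x) \<in> argmin_set f" if "x \<in> argmin_set \<phi>" for x
    using that by (auto simp: argmin_set_def effdom_def INF_f f_0)
  \<comment> \<open>A minimizer makes the infimum finite: its value is below
    \<open>\<infinity>\<close> by membership in the effective domain and differs from
    \<open>-\<infinity>\<close> by properness of \<open>g\<^sub>0\<close> and
    \<open>h\<close>.\<close>
  obtain x\<^sub>1 where x1: "x\<^sub>1 \<in> argmin_set \<phi>"
    using argmin_phi by blast
  then have "\<phi> x\<^sub>1 \<noteq> \<infinity>" "\<phi> x\<^sub>1 = (INF x. \<phi> x)"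
    by (auto simp: argmin_set_def effdom_def)
  moreover have "\<phi> x\<^sub>1 \<noteq> -\<infinity>"
    using ninf by (simp add: phi_def)
  ultimately obtain m where m: "(INF z. f z) = ereal m"
    using INF_f by (metis ereal_cases)
  interpret epi_limit fs f m
    by unfold_locales (rule epi, rule m)
  \<comment> \<open>The tolerances that recover the whole set of minimizers serve each single
    one.\<close>
  have f: "\<exists>\<epsilon>s. (\<forall>\<nu>. 0 \<le> \<epsilon>s \<nu>) \<and> \<epsilon>s \<longlonglongrightarrow> 0 \<and> (0, x\<^sub>0) \<in> LimInn (\<lambda>\<nu>. eps_argmin (\<epsilon>s \<nu>) (fs \<nu>))"
    if "ms \<longlonglongrightarrow> ereal m" and x0: "x\<^sub>0 \<in> argmin_set \<phi>" for x\<^sub>0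
    using eps_argmin_converges[OF that(1)] argmin_f[OF x0] unfolding set_converges_def by metis
  have g: "\<exists>\<epsilon>s. (\<forall>\<nu>. 0 \<le> \<epsilon>s \<nu>) \<and> \<epsilon>s \<longlonglongrightarrow> 0 \<and>
      set_converges (\<lambda>\<nu>. eps_argmin (\<epsilon>s \<nu>) (fs \<nu>)) (argmin_set f)"
    if "ms \<longlonglongrightarrow> ereal m"
    using eps_argmin_converges[OF that] by metis
  \<comment> \<open>Convergence of the infima yields tightness through a recovery sequence of the
    minimizer \<open>(0, x\<^sub>1)\<close>.\<close>
  have e: "ms \<longlonglongrightarrow> ereal m \<longleftrightarrow> tight_seq fs"
    using INF_tendsto_if_tight tight_if_INF_tendsto[OF _ argmin_f[OF x1]] by blast
  have d: "(ms \<longlongrightarrow> ereal m) (along N)"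
    if "\<epsilon>s \<longlonglongrightarrow> 0" "\<forall>\<nu>\<in>N. (u \<nu>, x \<nu>) \<in> eps_argmin (\<epsilon>s \<nu>) (fs \<nu>)"
      "((\<lambda>\<nu>. (u \<nu>, x \<nu>)) \<longlongrightarrow> z) (along N)" for \<epsilon>s N u x z
    using that by (rule INF_tendsto_along)
  have INF_\<phi>: "(INF x. \<phi> x) = ereal m"
    using INF_f m by simp
  show ?thesis
    unfolding m INF_\<phi>
    using epi eps_f LimOut_eps_argmin_subset f g
    by (intro conjI allI impI ballI refl e epi_converges_limsup_INF[OF epi, unfolded m])
      (assumption | elim conjE d | blast)+
qed

end
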